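(* Let $\mu$ be a probability measure on $\mathbb N^d$ with downward closed support, let $\mathcal L$ be the birth-death generator $$\mathcal Lf(\mathbf n)=\sum_{i=1}^d\frac{(n_i+1)\mu(\mathbf n+\mathbf e_i)}{\mu(\mathbf n)}\nabla_i^+f(\mathbf n)+\sum_{i=1}^dn_i\nabla_i^-f(\mathbf n),\qquad\mathbf n\in\mathrm{supp}(\mu),$$ and set $a(\mathbf n)=\mathbf n!\,\mu(\mathbf n)$ for $\mathbf n\in\mathbb N^d$. Then for all finitely supported functions $f,g:\mathrm{supp}(\mu)\to\mathbb R$, $$\begin{aligned}\mathbf E_\mu[\Gamma_2(f,g)]=\;&\mathbf E_{\mathbf n\sim\mu}\Big[\sum_{i,j\in[d]}\frac{a(\mathbf n+\mathbf e_i+\mathbf e_j)}{a(\mathbf n)}\,\nabla_i^+\nabla_j^+f(\mathbf n)\,\nabla_i^+\nabla_j^+g(\mathbf n)\Big]\\&+\mathbf E_{\mathbf n\sim\mu}\Big[\sum_{i,j\in[d]}\Big(\frac{a(\mathbf n+\mathbf e_i)\,a(\mathbf n+\mathbf e_j)}{a(\mathbf n)^2}-\frac{a(\mathbf n+\mathbf e_i+\mathbf e_j)}{a(\mathbf n)}\Big)\nabla_i^+f(\mathbf n)\,\nabla_j^+g(\mathbf n)\Big]\\&+\mathbf E_{\mathbf n\sim\mu}\Big[\sum_{i\in[d]}\frac{a(\mathbf n+\mathbf e_i)}{a(\mathbf n)}\,\nabla_i^+f(\mathbf n)\,\nabla_i^+g(\mathbf n)\Big].\end{aligned}$$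
   Context: $\mathbb N=\{0,1,2,\dots\}$, $[d]=\{1,\dots,d\}$, $\mathbf e_i$ is the $i$-th standard basis vector, $\mathbf n!=\prod_in_i!$, $\mathrm{supp}(\mu)=\{\mathbf n:\mu(\mathbf n)>0\}$. A set $S\subseteq\mathbb N^d$ is downward closed if $\mathbf n\in S$ and $\mathbf 0\le\mathbf m\le\mathbf n$ (coordinatewise) imply $\mathbf m\in S$. Differences: $\nabla_i^+f(\mathbf n)=f(\mathbf n+\mathbf e_i)-f(\mathbf n)$, $\nabla_i^-f(\mathbf n)=f(\mathbf n-\mathbf e_i)-f(\mathbf n)$, and $\nabla_i^+\nabla_j^+f(\mathbf n)=f(\mathbf n+\mathbf e_i+\mathbf e_j)-f(\mathbf n+\mathbf e_i)-f(\mathbf n+\mathbf e_j)+f(\mathbf n)$. Whenever a neighbouring state lies outside $\mathrm{supp}(\mu)$, the corresponding coefficient is $0$ and the term is interpreted as $0$. The carré du champ operators of $\mathcal L$ are $\Gamma(f,g)=\frac12[\mathcal L(fg)-f\mathcal Lg-g\mathcal Lf]$ and $\Gamma_2(f,g)=\frac12[\mathcal L\Gamma(f,g)-\Gamma(f,\mathcal Lg)-\Gamma(g,\mathcal Lf)]$. *)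

theory Defs
  imports "HOL-Probability.Probability"
begin

text \<open>
  The index type \<open>'d\<close> plays the role of \<open>{1, ..., d}\<close> and \<open>nat ^ 'd\<close> that of the lattice of
  d-tuples of natural numbers; its order \<open>\<le>\<close> is coordinatewise and \<open>axis i 1\<close> is the i-th
  standard basis vector. A probability measure on this countable set is a \<open>pmf\<close>, whose support
  is \<open>set_pmf\<close>.

  A function on the support is represented by a total function. The values outside the support are
  irrelevant when the support is downward closed: for \<open>n\<close> in the support, every term below that
  looks at a state outside the support (or at \<open>n - axis i 1\<close> with \<open>n $ i = 0\<close>, where the
  subtraction is truncated) carries a coefficient equal to 0.
\<close>

definition downward_closed :: "(nat ^ 'd::finite) set \<Rightarrow> bool" where
  "downward_closed S \<longleftrightarrow> (\<forall>n\<in>S. \<forall>m\<le>n. m \<in> S)"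

definition fdiff :: "'d::finite \<Rightarrow> (nat ^ 'd \<Rightarrow> real) \<Rightarrow> nat ^ 'd \<Rightarrow> real" where
  "fdiff i f n = f (n + axis i 1) - f n"

definition bdiff :: "'d::finite \<Rightarrow> (nat ^ 'd \<Rightarrow> real) \<Rightarrow> nat ^ 'd \<Rightarrow> real" where
  "bdiff i f n = f (n - axis i 1) - f n"

definition birth_death :: "(nat ^ 'd::finite) pmf \<Rightarrow> (nat ^ 'd \<Rightarrow> real) \<Rightarrow> nat ^ 'd \<Rightarrow> real" where
  "birth_death \<mu> f n =
     (\<Sum>i\<in>UNIV. (real (n $ i) + 1) * pmf \<mu> (n + axis i 1) / pmf \<mu> n * fdiff i f n)
     + (\<Sum>i\<in>UNIV. real (n $ i) * bdiff i f n)"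

definition carre_du_champ ::
  "(('a \<Rightarrow> real) \<Rightarrow> 'a \<Rightarrow> real) \<Rightarrow> ('a \<Rightarrow> real) \<Rightarrow> ('a \<Rightarrow> real) \<Rightarrow> 'a \<Rightarrow> real" where
  "carre_du_champ L f g n = 1 / 2 * (L (\<lambda>m. f m * g m) n - f n * L g n - g n * L f n)"

definition carre_du_champ2 ::
  "(('a \<Rightarrow> real) \<Rightarrow> 'a \<Rightarrow> real) \<Rightarrow> ('a \<Rightarrow> real) \<Rightarrow> ('a \<Rightarrow> real) \<Rightarrow> 'a \<Rightarrow> real" where
  "carre_du_champ2 L f g n =
     1 / 2 * (L (carre_du_champ L f g) n - carre_du_champ L f (L g) n - carre_du_champ L g (L f) n)"

definition fact_weight :: "(nat ^ 'd::finite) pmf \<Rightarrow> nat ^ 'd \<Rightarrow> real" where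
  "fact_weight \<mu> n = (\<Prod>i\<in>UNIV. fact (n $ i)) * pmf \<mu> n"

end

theory Submission
  imports Defs
begin

text \<open>
  Write \<open>b\<^sub>i(n) = a(n + e\<^sub>i) / a(n)\<close> for the birth rates. Detailed balance gives
  \<open>E[n\<^sub>i F(n)] = E[b\<^sub>i(n) F(n + e\<^sub>i)]\<close>, hence \<open>E[h \<L>f] = - \<Sum>\<^sub>i E[b\<^sub>i \<nabla>\<^sub>if \<nabla>\<^sub>ih]\<close>: the generator is
  symmetric and has mean zero, so that \<open>E[\<Gamma>\<^sub>2(f,g)] = E[\<L>f \<L>g] = - \<Sum>\<^sub>i E[b\<^sub>i \<nabla>\<^sub>if \<nabla>\<^sub>i\<L>g]\<close>.
  Commuting \<open>\<nabla>\<^sub>i\<close> with \<open>\<L>\<close> produces the last two terms of the formula and the terms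
  \<open>b\<^sub>j(n + e\<^sub>i) \<nabla>\<^sub>i\<nabla>\<^sub>jg(n) - n\<^sub>j \<nabla>\<^sub>i\<nabla>\<^sub>jg(n - e\<^sub>j)\<close>; applying detailed balance to the second of these
  gives the term with the product of second differences.
\<close>

section \<open>Birth rates and shifts of lattice points\<close>

text \<open>Using \<open>fact_weight\<close> makes products of rates along a lattice path telescope.
  Off the support the quotient is 0, by division by zero.\<close>

definition birth_rate :: "(nat ^ 'd::finite) pmf \<Rightarrow> 'd \<Rightarrow> nat ^ 'd \<Rightarrow> real" where
  "birth_rate \<mu> i n = fact_weight \<mu> (n + axis i 1) / fact_weight \<mu> n"

lemma prod_fact_add_axis:
  fixes n :: "nat ^ 'd::finite"
  shows "(\<Prod>j\<in>UNIV. fact ((n + axis i 1) $ j) :: real) = (real (n $ i) + 1) * (\<Prod>j\<in>UNIV. fact (n $ j))"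
proof -
  have "(\<Prod>j\<in>UNIV. fact ((n + axis i 1) $ j) :: real)
      = (\<Prod>j\<in>UNIV. (if j = i then real (n $ i) + 1 else 1) * fact (n $ j))"
    by (intro prod.cong) (auto simp: axis_def)
  then show ?thesis
    by (simp add: prod.distrib)
qed

text \<open>Simplification would otherwise turn \<open>axis i 1\<close> into
  \<open>axis i (Suc 0)\<close>, which facts stated with \<open>1\<close> do not match.\<close>

declare One_nat_def [simp del]

lemma birth_rate_eq:
  "birth_rate \<mu> i n = (real (n $ i) + 1) * pmf \<mu> (n + axis i 1) / pmf \<mu> n"
  unfolding birth_rate_def fact_weight_def prod_fact_add_axis by simp

lemma birth_death_eq:
  "birth_death \<mu> f n =
    (\<Sum>i\<in>UNIV. birth_rate \<mu> i n * fdiff i f n) + (\<Sum>i\<in>UNIV. real (n $ i) * bdiff i f n)"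
  by (simp add: birth_death_def birth_rate_eq)

lemma birth_rate_eq_0: "n + axis i 1 \<notin> set_pmf \<mu> \<Longrightarrow> birth_rate \<mu> i n = 0"
  by (simp add: birth_rate_eq set_pmf_iff)

text \<open>The condition excludes truncated subtraction; in the opposite order no truncation can
  occur.\<close>

lemma minus_axis_add_axis:
  fixes n :: "nat ^ 'd::finite"
  shows "n $ i \<noteq> 0 \<Longrightarrow> n - axis i 1 + axis i 1 = n"
  by (auto simp: vec_eq_iff axis_def)

lemma add_axis_minus_axis:
  fixes n :: "nat ^ 'd::finite"
  shows "n + axis i 1 - axis i 1 = n"
  by (auto simp: vec_eq_iff)

section \<open>Commuting a forward difference with the generator\<close>

lemma fdiff_commute: "fdiff i (fdiff j f) n = fdiff j (fdiff i f) n"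
  by (simp add: fdiff_def algebra_simps)

text \<open>A backward difference at \<open>m\<close> is minus the forward difference at
  \<open>m - axis j 1\<close> when \<open>m $ j > 0\<close>. Shifting by \<open>axis i 1\<close>
  thus produces a second difference, and for \<open>j = i\<close> the death rate also grows by one;
  this unit is the source of the last expectation in the theorem.\<close>

lemma death_part_shift:
  fixes n :: "nat ^ 'd::finite"
  shows "real ((n + axis i 1) $ j) * bdiff j g (n + axis i 1) - real (n $ j) * bdiff j g n
    = - real (n $ j) * fdiff i (fdiff j g) (n - axis j 1) - (if j = i then fdiff i g n else 0)"
proof (cases "n $ j = 0")
  \<comment> \<open>Truncation leaves \<open>n - axis j 1 = n\<close> here, but the weight
    \<open>n $ j = 0\<close> removes the terms that contain it.\<close>
  case True
  then show ?thesis
    by (cases "j = i") (simp_all add: bdiff_def fdiff_def add_axis_minus_axis, simp_all add: axis_def)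
next
  case False
  have 1: "n - axis j 1 + axis j 1 = n"
    using False by (rule minus_axis_add_axis)
  have 2: "n - axis j 1 + axis i 1 + axis j 1 = n + axis i 1"
    using 1 by (metis add.commute add.left_commute)
  have 3: "n + axis i 1 - axis j 1 = n - axis j 1 + axis i 1"
    using 2 by (metis add_axis_minus_axis)
  show ?thesis
  proof (cases "j = i")
    case True
    have "real ((n + axis i 1) $ i) = real (n $ i) + 1"
      by (simp add: axis_def)
    then show ?thesis
      using 1 2 3 True by (simp add: bdiff_def fdiff_def algebra_simps)
  next
    case False
    then have "(n + axis i 1) $ j = n $ j"
      by (simp add: axis_def)
    then show ?thesis
      using 1 2 3 False by (simp add: bdiff_def fdiff_def algebra_simps)
  qed
qed

text \<open>The product rule is taken with the rate of the second difference at the shifted point,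
  so that a further factor \<open>birth_rate \<mu> i n\<close> gives the rate of two successive
  births.\<close>

lemma fdiff_birth_death:
  "fdiff i (birth_death \<mu> g) n =
    (\<Sum>j\<in>UNIV. birth_rate \<mu> j (n + axis i 1) * fdiff i (fdiff j g) n)
    + (\<Sum>j\<in>UNIV. (birth_rate \<mu> j (n + axis i 1) - birth_rate \<mu> j n) * fdiff j g n)
    - (\<Sum>j\<in>UNIV. real (n $ j) * fdiff i (fdiff j g) (n - axis j 1)) - fdiff i g n"
proof -
  have "fdiff i (birth_death \<mu> g) n
      = (\<Sum>j\<in>UNIV. birth_rate \<mu> j (n + axis i 1) * fdiff j g (n + axis i 1)
          - birth_rate \<mu> j n * fdiff j g n)
        + (\<Sum>j\<in>UNIV. real ((n + axis i 1) $ j) * bdiff j g (n + axis i 1)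
          - real (n $ j) * bdiff j g n)"
    by (simp only: fdiff_def[of i "birth_death \<mu> g"] birth_death_eq sum_subtractf)
  also have "(\<Sum>j\<in>UNIV. birth_rate \<mu> j (n + axis i 1) * fdiff j g (n + axis i 1)
          - birth_rate \<mu> j n * fdiff j g n)
      = (\<Sum>j\<in>UNIV. birth_rate \<mu> j (n + axis i 1) * fdiff i (fdiff j g) n
          + (birth_rate \<mu> j (n + axis i 1) - birth_rate \<mu> j n) * fdiff j g n)"
    by (intro sum.cong) (simp_all add: fdiff_def[of i "fdiff _ g"] algebra_simps)
  also have "(\<Sum>j\<in>UNIV. real ((n + axis i 1) $ j) * bdiff j g (n + axis i 1)
          - real (n $ j) * bdiff j g n)
      = - (\<Sum>j\<in>UNIV. real (n $ j) * fdiff i (fdiff j g) (n - axis j 1)) - fdiff i g n"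
    unfolding death_part_shift by (simp add: sum_subtractf sum_negf)
  finally show ?thesis
    by (simp add: sum.distrib)
qed

section \<open>Functions with finite support relative to the measure\<close>

definition finite_supp :: "'a pmf \<Rightarrow> ('a \<Rightarrow> real) \<Rightarrow> bool" where
  "finite_supp \<mu> F \<longleftrightarrow> finite {n \<in> set_pmf \<mu>. F n \<noteq> 0}"

lemma finite_supp_subset:
  assumes "finite_supp \<mu> F" "\<And>n. n \<in> set_pmf \<mu> \<Longrightarrow> F n = 0 \<Longrightarrow> G n = 0"
  shows "finite_supp \<mu> G"
  using assms(1) unfolding finite_supp_def by (rule rev_finite_subset) (use assms(2) in auto)

lemma finite_supp_add:
  assumes "finite_supp \<mu> F" "finite_supp \<mu> G"
  shows "finite_supp \<mu> (\<lambda>n. F n + G n)"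
proof -
  have "finite ({n \<in> set_pmf \<mu>. F n \<noteq> 0} \<union> {n \<in> set_pmf \<mu>. G n \<noteq> 0})"
    using assms by (simp add: finite_supp_def)
  then show ?thesis
    unfolding finite_supp_def by (rule rev_finite_subset) auto
qed

lemma finite_supp_mult_left: "finite_supp \<mu> F \<Longrightarrow> finite_supp \<mu> (\<lambda>n. h n * F n)"
  by (erule finite_supp_subset) simp

lemma finite_supp_mult_right: "finite_supp \<mu> F \<Longrightarrow> finite_supp \<mu> (\<lambda>n. F n * h n)"
  by (erule finite_supp_subset) simp

lemma finite_supp_diff:
  "finite_supp \<mu> F \<Longrightarrow> finite_supp \<mu> G \<Longrightarrow> finite_supp \<mu> (\<lambda>n. F n - G n)"
  using finite_supp_add[of \<mu> F "\<lambda>n. - 1 * G n"] finite_supp_mult_left[of \<mu> G "\<lambda>_. - 1"] by simp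

lemma finite_supp_sum:
  assumes "\<And>i. i \<in> I \<Longrightarrow> finite_supp \<mu> (F i)"
  shows "finite_supp \<mu> (\<lambda>n. \<Sum>i\<in>I. F i n)"
  using assms
proof (induction I rule: infinite_finite_induct)
  case (insert i I)
  then show ?case by (simp add: finite_supp_add)
qed (simp_all add: finite_supp_def)

text \<open>Off \<open>set_pmf \<mu>\<close> the function is arbitrary, so it is compared almost
  everywhere with a finite combination of indicators of points.\<close>

lemma integrable_finite_supp:
  assumes "finite_supp \<mu> F"
  shows "integrable (measure_pmf \<mu>) F"
proof -
  let ?A = "{n \<in> set_pmf \<mu>. F n \<noteq> 0}"
  have "integrable (measure_pmf \<mu>) (\<lambda>n. \<Sum>m\<in>?A. indicator {m} n * F m)"
    by (intro Bochner_Integration.integrable_sum integrable_mult_left) (auto simp: less_top[symmetric])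
  moreover have "AE n in measure_pmf \<mu>. (\<Sum>m\<in>?A. indicator {m} n * F m) = F n"
  proof (rule AE_pmfI)
    fix n
    assume "n \<in> set_pmf \<mu>"
    moreover have "finite ?A"
      using assms by (simp add: finite_supp_def)
    ultimately show "(\<Sum>m\<in>?A. indicator {m} n * F m) = F n"
      by (cases "F n = 0") (simp_all add: indicator_def)
  qed
  ultimately show ?thesis
    by (subst integrable_cong_AE[symmetric]) auto
qed

section \<open>Rates and finiteness on a downward closed support\<close>

context
  fixes \<mu> :: "(nat ^ 'd::finite) pmf"
  assumes dc: "downward_closed (set_pmf \<mu>)"
begin

lemma set_pmf_add_axisD: "n + axis i 1 \<in> set_pmf \<mu> \<Longrightarrow> n \<in> set_pmf \<mu>"
  using dc by (auto simp: downward_closed_def less_eq_vec_def)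

lemma set_pmf_minus_axis: "n \<in> set_pmf \<mu> \<Longrightarrow> n - axis i 1 \<in> set_pmf \<mu>"
  using dc by (auto simp: downward_closed_def less_eq_vec_def)

text \<open>The intermediate weight cancels. If it is 0, downward closure makes the weight at the
  endpoint 0 too, and both sides vanish.\<close>

lemma birth_rate_mult:
  "birth_rate \<mu> i n * birth_rate \<mu> j (n + axis i 1)
    = fact_weight \<mu> (n + axis i 1 + axis j 1) / fact_weight \<mu> n"
proof (cases "fact_weight \<mu> (n + axis i 1) = 0")
  case True
  then have "n + axis i 1 \<notin> set_pmf \<mu>"
    by (simp add: fact_weight_def set_pmf_iff)
  then have "n + axis i 1 + axis j 1 \<notin> set_pmf \<mu>"
    using set_pmf_add_axisD by blast
  then have "fact_weight \<mu> (n + axis i 1 + axis j 1) = 0"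
    by (simp add: fact_weight_def set_pmf_iff)
  then show ?thesis
    by (simp add: birth_rate_def True)
qed (simp add: birth_rate_def)

lemma birth_rate_mult_commute:
  "birth_rate \<mu> i n * birth_rate \<mu> j (n + axis i 1) = birth_rate \<mu> j n * birth_rate \<mu> i (n + axis j 1)"
  by (simp add: birth_rate_mult add.assoc add.commute[of "axis i 1"])

text \<open>A nonzero rate forces \<open>n + axis i 1\<close> into the support, so the shift embeds
  the relevant points into those of \<open>F\<close>. The rate thereby screens off values of
  \<open>F\<close> outside the support.\<close>

lemma finite_supp_birth:
  assumes "finite_supp \<mu> F"
  shows "finite_supp \<mu> (\<lambda>n. birth_rate \<mu> i n * F (n + axis i 1))"
proof -
  let ?B = "{n \<in> set_pmf \<mu>. birth_rate \<mu> i n * F (n + axis i 1) \<noteq> 0}"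
  have "inj_on (\<lambda>n. n + axis i 1) ?B"
    by (auto simp: inj_on_def)
  moreover have "(\<lambda>n. n + axis i 1) ` ?B \<subseteq> {n \<in> set_pmf \<mu>. F n \<noteq> 0}"
    using birth_rate_eq_0 by fastforce
  ultimately show ?thesis
    using assms unfolding finite_supp_def by (meson inj_on_finite)
qed

lemma finite_supp_death:
  assumes "finite_supp \<mu> F"
  shows "finite_supp \<mu> (\<lambda>n. real (n $ i) * F (n - axis i 1))"
proof -
  have "finite ((\<lambda>n. n + axis i 1) ` {n \<in> set_pmf \<mu>. F n \<noteq> 0})"
    using assms by (simp add: finite_supp_def)
  moreover have "n \<in> (\<lambda>n. n + axis i 1) ` {n \<in> set_pmf \<mu>. F n \<noteq> 0}"
    if "n \<in> set_pmf \<mu>" "n $ i \<noteq> 0" "F (n - axis i 1) \<noteq> 0" for n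
    using that set_pmf_minus_axis[of n i] minus_axis_add_axis[of n i]
    by (intro image_eqI[of _ _ "n - axis i 1"]) auto
  ultimately show ?thesis
    unfolding finite_supp_def by (elim rev_finite_subset) auto
qed

lemma finite_supp_birth_fdiff:
  assumes "finite_supp \<mu> F"
  shows "finite_supp \<mu> (\<lambda>n. birth_rate \<mu> i n * fdiff i F n)"
  using finite_supp_diff[OF finite_supp_birth[OF assms, of i] finite_supp_mult_left[OF assms]]
  by (simp add: fdiff_def right_diff_distrib)

lemma finite_supp_death_bdiff:
  assumes "finite_supp \<mu> F"
  shows "finite_supp \<mu> (\<lambda>n. real (n $ i) * bdiff i F n)"
  using finite_supp_diff[OF finite_supp_death[OF assms, of i] finite_supp_mult_left[OF assms]]
  by (simp add: bdiff_def right_diff_distrib)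

lemma finite_supp_birth_death: "finite_supp \<mu> F \<Longrightarrow> finite_supp \<mu> (birth_death \<mu> F)"
  unfolding birth_death_eq[abs_def]
  by (intro finite_supp_add finite_supp_sum finite_supp_birth_fdiff finite_supp_death_bdiff)

lemma finite_supp_carre_du_champ:
  "finite_supp \<mu> F \<Longrightarrow> finite_supp \<mu> G \<Longrightarrow> finite_supp \<mu> (carre_du_champ (birth_death \<mu>) F G)"
  unfolding carre_du_champ_def[abs_def]
  by (intro finite_supp_mult_left finite_supp_diff finite_supp_birth_death)

section \<open>Reversibility and summation by parts\<close>

text \<open>Substitute \<open>n + axis i 1\<close> for \<open>n\<close> and use that
  \<open>(n $ i + 1) * pmf \<mu> (n + axis i 1)\<close> equals
  \<open>birth_rate \<mu> i n * pmf \<mu> n\<close> on the support. States with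
  \<open>n $ i = 0\<close> contribute nothing.\<close>

lemma detailed_balance:
  assumes "finite_supp \<mu> (\<lambda>n. real (n $ i) * F n)"
  shows "measure_pmf.expectation \<mu> (\<lambda>n. real (n $ i) * F n)
    = measure_pmf.expectation \<mu> (\<lambda>n. birth_rate \<mu> i n * F (n + axis i 1))"
proof -
  let ?A = "{n \<in> set_pmf \<mu>. real (n $ i) * F n \<noteq> 0}"
  let ?B = "{n. n + axis i 1 \<in> ?A}"
  \<comment> \<open>Points of \<open>?A\<close> have a nonzero \<open>i\<close>-th coordinate, so
    the shift reaches all of them.\<close>
  have bij: "bij_betw (\<lambda>n. n + axis i 1) ?B ?A"
  proof (rule bij_betwI')
    fix m
    assume "m \<in> ?A"
    then have "m = m - axis i 1 + axis i 1"
      using minus_axis_add_axis[of m i] by simp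
    with \<open>m \<in> ?A\<close> show "\<exists>n\<in>?B. m = n + axis i 1"
      by (intro bexI[of _ "m - axis i 1"]) simp_all
  qed auto
  have fin: "finite ?A"
    using assms by (simp add: finite_supp_def)
  then have finB: "finite ?B"
    using bij_betw_finite[OF bij] by simp
  have "measure_pmf.expectation \<mu> (\<lambda>n. real (n $ i) * F n)
      = (\<Sum>n\<in>?A. pmf \<mu> n *\<^sub>R (real (n $ i) * F n))"
    using fin by (intro integral_measure_pmf) auto
  also have "\<dots> = (\<Sum>n\<in>?B. pmf \<mu> (n + axis i 1) *\<^sub>R (real ((n + axis i 1) $ i) * F (n + axis i 1)))"
    by (rule sum.reindex_bij_betw[OF bij, symmetric])
  also have "\<dots> = (\<Sum>n\<in>?B. pmf \<mu> n *\<^sub>R (birth_rate \<mu> i n * F (n + axis i 1)))"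
  proof (intro sum.cong refl)
    fix n
    assume "n \<in> ?B"
    then have "pmf \<mu> n \<noteq> 0"
      using set_pmf_add_axisD[of n i] by (auto simp: set_pmf_iff)
    then show "pmf \<mu> (n + axis i 1) *\<^sub>R (real ((n + axis i 1) $ i) * F (n + axis i 1))
        = pmf \<mu> n *\<^sub>R (birth_rate \<mu> i n * F (n + axis i 1))"
      by (simp add: birth_rate_eq axis_def)
  qed
  also have "\<dots> = measure_pmf.expectation \<mu> (\<lambda>n. birth_rate \<mu> i n * F (n + axis i 1))"
  proof (rule integral_measure_pmf[OF finB, symmetric])
    fix n
    assume "birth_rate \<mu> i n * F (n + axis i 1) \<noteq> 0"
    then show "n \<in> ?B"
      using birth_rate_eq_0[of n i \<mu>] by (auto simp: axis_def)
  qed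
  finally show ?thesis .
qed

text \<open>Detailed balance turns each death term into a birth term of opposite sign with
  \<open>h\<close> at the endpoint; the births supply \<open>h\<close> at the starting point.
  Finiteness comes from \<open>f\<close>, so \<open>h\<close> can be the constant 1 as well as
  \<open>birth_death \<mu> g\<close>.\<close>

lemma expectation_birth_death_mult:
  assumes f: "finite_supp \<mu> f"
  shows "measure_pmf.expectation \<mu> (\<lambda>n. birth_death \<mu> f n * h n)
    = - (\<Sum>i\<in>UNIV. measure_pmf.expectation \<mu> (\<lambda>n. birth_rate \<mu> i n * fdiff i f n * fdiff i h n))"
proof -
  let ?E = "measure_pmf.expectation \<mu>"
  have 1: "integrable \<mu> (\<lambda>n. birth_rate \<mu> i n * fdiff i f n * u n)" for i u
    by (intro integrable_finite_supp finite_supp_mult_right finite_supp_birth_fdiff f)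
  have fs2: "finite_supp \<mu> (\<lambda>n. real (n $ i) * bdiff i f n * h n)" for i
    by (intro finite_supp_mult_right finite_supp_death_bdiff f)
  have 3: "?E (\<lambda>n. real (n $ i) * bdiff i f n * h n)
      = - ?E (\<lambda>n. birth_rate \<mu> i n * fdiff i f n * h (n + axis i 1))" for i
  proof -
    have "?E (\<lambda>n. real (n $ i) * (bdiff i f n * h n))
        = ?E (\<lambda>n. birth_rate \<mu> i n * (bdiff i f (n + axis i 1) * h (n + axis i 1)))"
      by (rule detailed_balance) (use fs2[of i] in \<open>simp add: mult.assoc\<close>)
    also have "\<dots> = ?E (\<lambda>n. - (birth_rate \<mu> i n * fdiff i f n * h (n + axis i 1)))"
      by (intro Bochner_Integration.integral_cong refl)
        (simp add: bdiff_def fdiff_def add_axis_minus_axis algebra_simps)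
    finally show ?thesis
      by (simp add: mult.assoc)
  qed
  have "?E (\<lambda>n. birth_death \<mu> f n * h n)
      = ?E (\<lambda>n. (\<Sum>i\<in>UNIV. birth_rate \<mu> i n * fdiff i f n * h n)
          + (\<Sum>i\<in>UNIV. real (n $ i) * bdiff i f n * h n))"
    by (simp add: birth_death_eq distrib_right sum_distrib_right)
  also have "\<dots> = (\<Sum>i\<in>UNIV. ?E (\<lambda>n. birth_rate \<mu> i n * fdiff i f n * h n))
      + (\<Sum>i\<in>UNIV. ?E (\<lambda>n. real (n $ i) * bdiff i f n * h n))"
    by (subst Bochner_Integration.integral_add)
      (auto intro!: Bochner_Integration.integrable_sum 1 integrable_finite_supp[OF fs2]
        simp: Bochner_Integration.integral_sum 1 integrable_finite_supp[OF fs2])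
  also have "\<dots> = - (\<Sum>i\<in>UNIV. ?E (\<lambda>n. birth_rate \<mu> i n * fdiff i f n * h (n + axis i 1))
      - ?E (\<lambda>n. birth_rate \<mu> i n * fdiff i f n * h n))"
    by (simp add: 3 sum_negf sum_subtractf)
  also have "\<dots> = - (\<Sum>i\<in>UNIV. ?E (\<lambda>n. birth_rate \<mu> i n * fdiff i f n * fdiff i h n))"
    by (simp add: 1 fdiff_def[of _ h] right_diff_distrib)
  finally show ?thesis .
qed

lemma expectation_birth_death:
  "finite_supp \<mu> F \<Longrightarrow> measure_pmf.expectation \<mu> (birth_death \<mu> F) = 0"
  using expectation_birth_death_mult[of F "\<lambda>_. 1"] by (simp add: fdiff_def)

lemma expectation_birth_death_symmetric:
  assumes "finite_supp \<mu> f" "finite_supp \<mu> g"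
  shows "measure_pmf.expectation \<mu> (\<lambda>n. f n * birth_death \<mu> g n)
    = measure_pmf.expectation \<mu> (\<lambda>n. g n * birth_death \<mu> f n)"
proof -
  have "measure_pmf.expectation \<mu> (\<lambda>n. birth_death \<mu> g n * f n)
      = measure_pmf.expectation \<mu> (\<lambda>n. birth_death \<mu> f n * g n)"
    unfolding expectation_birth_death_mult[OF assms(1)] expectation_birth_death_mult[OF assms(2)]
    by (simp add: mult.assoc mult.commute[of "fdiff _ f _"])
  then show ?thesis
    by (simp add: mult.commute)
qed

section \<open>Expectations of the carre du champ operators\<close>

text \<open>The generator applied to the product has mean zero, and the other two terms agree by
  symmetry.\<close>

lemma expectation_carre_du_champ:
  assumes "finite_supp \<mu> f" "finite_supp \<mu> g"
  shows "measure_pmf.expectation \<mu> (carre_du_champ (birth_death \<mu>) f g)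
    = - measure_pmf.expectation \<mu> (\<lambda>n. g n * birth_death \<mu> f n)"
proof -
  have fg: "finite_supp \<mu> (\<lambda>n. f n * g n)"
    by (intro finite_supp_mult_left assms)
  have "integrable \<mu> (birth_death \<mu> (\<lambda>m. f m * g m))"
    "integrable \<mu> (\<lambda>n. f n * birth_death \<mu> g n)" "integrable \<mu> (\<lambda>n. g n * birth_death \<mu> f n)"
    by (intro integrable_finite_supp finite_supp_mult_left finite_supp_birth_death fg assms)+
  then show ?thesis
    unfolding carre_du_champ_def[abs_def]
    by (simp add: expectation_birth_death[OF fg] expectation_birth_death_symmetric[OF assms])
qed

text \<open>The leading term has mean zero; each of the other two contributes half of the right-hand
  side.\<close>

lemma expectation_carre_du_champ2:
  assumes "finite_supp \<mu> f" "finite_supp \<mu> g"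
  shows "measure_pmf.expectation \<mu> (carre_du_champ2 (birth_death \<mu>) f g)
    = measure_pmf.expectation \<mu> (\<lambda>n. birth_death \<mu> f n * birth_death \<mu> g n)"
proof -
  let ?L = "birth_death \<mu>"
  let ?\<Gamma> = "carre_du_champ ?L"
  note fs = assms assms[THEN finite_supp_birth_death]
  have "integrable \<mu> (?L (?\<Gamma> f g))" "integrable \<mu> (?\<Gamma> f (?L g))" "integrable \<mu> (?\<Gamma> g (?L f))"
    by (intro integrable_finite_supp finite_supp_carre_du_champ finite_supp_birth_death fs)+
  then show ?thesis
    unfolding carre_du_champ2_def[abs_def]
    by (simp add: expectation_birth_death finite_supp_carre_du_champ
        expectation_carre_du_champ fs mult.commute)
qed

text \<open>This is the contribution of one direction \<open>i\<close>; summing over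
  \<open>i\<close> gives the theorem.\<close>

lemma expectation_birth_fdiff_fdiff_birth_death:
  assumes f: "finite_supp \<mu> f" and g: "finite_supp \<mu> g"
  defines "c \<equiv> \<lambda>i j n. birth_rate \<mu> i n * birth_rate \<mu> j (n + axis i 1)"
  shows "- measure_pmf.expectation \<mu> (\<lambda>n. birth_rate \<mu> i n * fdiff i f n * fdiff i (birth_death \<mu> g) n)
    = measure_pmf.expectation \<mu> (\<lambda>n. \<Sum>j\<in>UNIV. c i j n * fdiff i (fdiff j f) n * fdiff i (fdiff j g) n)
    + measure_pmf.expectation \<mu> (\<lambda>n. \<Sum>j\<in>UNIV.
        (birth_rate \<mu> i n * birth_rate \<mu> j n - c i j n) * fdiff i f n * fdiff j g n)
    + measure_pmf.expectation \<mu> (\<lambda>n. birth_rate \<mu> i n * fdiff i f n * fdiff i g n)"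
proof -
  let ?E = "measure_pmf.expectation \<mu>"
  \<comment> \<open>In the expansion by \<open>fdiff_birth_death\<close>, \<open>P\<close> collects
    the second differences from births, \<open>Q\<close> the change of the rates and
    \<open>R\<close> the second differences from deaths; \<open>R'\<close> is \<open>R\<close> after
    detailed balance in each direction \<open>j\<close>.\<close>
  define U where "U n = birth_rate \<mu> i n * fdiff i f n" for n
  define P where "P n = (\<Sum>j\<in>UNIV. c i j n * fdiff i f n * fdiff i (fdiff j g) n)" for n
  define Q where "Q n = (\<Sum>j\<in>UNIV.
    (birth_rate \<mu> i n * birth_rate \<mu> j n - c i j n) * fdiff i f n * fdiff j g n)" for n
  define R where "R n = (\<Sum>j\<in>UNIV. real (n $ j) * (U n * fdiff i (fdiff j g) (n - axis j 1)))" for n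
  define R' where "R' n = (\<Sum>j\<in>UNIV. birth_rate \<mu> j n * (U (n + axis j 1) * fdiff i (fdiff j g) n))" for n
  have U: "finite_supp \<mu> U"
    unfolding U_def[abs_def] by (rule finite_supp_birth_fdiff[OF f])
  have Rterm: "finite_supp \<mu> (\<lambda>n. real (n $ j) * (U n * fdiff i (fdiff j g) (n - axis j 1)))" for j
    by (intro finite_supp_mult_left finite_supp_mult_right U)
  have R'term: "finite_supp \<mu> (\<lambda>n. birth_rate \<mu> j n * (U (n + axis j 1) * fdiff i (fdiff j g) n))" for j
    using finite_supp_mult_right[OF finite_supp_birth[OF U]] by (simp add: mult.assoc)
  have int: "integrable \<mu> P" "integrable \<mu> Q" "integrable \<mu> R" "integrable \<mu> R'"
    "integrable \<mu> (\<lambda>n. U n * fdiff i g n)"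
  proof -
    show "integrable \<mu> P" "integrable \<mu> Q"
      unfolding P_def[abs_def] Q_def[abs_def]
      by (intro integrable_finite_supp finite_supp_sum; rule finite_supp_subset[OF U];
          auto simp: U_def c_def)+
    show "integrable \<mu> R" "integrable \<mu> R'" "integrable \<mu> (\<lambda>n. U n * fdiff i g n)"
      unfolding R_def[abs_def] R'_def[abs_def]
      by (intro integrable_finite_supp finite_supp_sum Rterm R'term finite_supp_mult_right U)+
  qed
  have "- (birth_rate \<mu> i n * fdiff i f n * fdiff i (birth_death \<mu> g) n)
      = Q n + U n * fdiff i g n + R n - P n" for n
    unfolding fdiff_birth_death P_def Q_def R_def U_def c_def
    by (simp add: algebra_simps sum_distrib_left sum.distrib sum_subtractf)
  then have "- ?E (\<lambda>n. birth_rate \<mu> i n * fdiff i f n * fdiff i (birth_death \<mu> g) n)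
      = ?E (\<lambda>n. Q n + U n * fdiff i g n + R n - P n)"
    by (subst Bochner_Integration.integral_minus[symmetric]) simp
  also have "\<dots> = ?E Q + ?E (\<lambda>n. U n * fdiff i g n) + ?E R - ?E P"
    by (simp add: int)
  also have "?E R = ?E R'"
  proof -
    have "?E (\<lambda>n. real (n $ j) * (U n * fdiff i (fdiff j g) (n - axis j 1)))
        = ?E (\<lambda>n. birth_rate \<mu> j n * (U (n + axis j 1) * fdiff i (fdiff j g) n))" for j
      by (subst detailed_balance[OF Rterm]) (simp add: add_axis_minus_axis)
    then show ?thesis
      unfolding R_def[abs_def] R'_def[abs_def]
      by (simp add: Bochner_Integration.integral_sum integrable_finite_supp Rterm R'term)
  qed
  finally have "- ?E (\<lambda>n. birth_rate \<mu> i n * fdiff i f n * fdiff i (birth_death \<mu> g) n)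
      = ?E (\<lambda>n. R' n - P n) + ?E Q + ?E (\<lambda>n. U n * fdiff i g n)"
    by (simp add: int)
  moreover have "R' n - P n
      = (\<Sum>j\<in>UNIV. c i j n * fdiff i (fdiff j f) n * fdiff i (fdiff j g) n)" for n
  proof -
    \<comment> \<open>Exchanging the order of the two births gives \<open>R'\<close> the same weight
      \<open>c i j n\<close> as \<open>P\<close>, so the values of \<open>fdiff i f\<close> at
      \<open>n + axis j 1\<close> and \<open>n\<close> combine into a second difference.\<close>
    have "birth_rate \<mu> j n * (U (n + axis j 1) * fdiff i (fdiff j g) n)
        = c i j n * fdiff i f (n + axis j 1) * fdiff i (fdiff j g) n" for j
      unfolding c_def U_def birth_rate_mult_commute[of i n j] by simp
    then have "R' n - P n
        = (\<Sum>j\<in>UNIV. c i j n * fdiff j (fdiff i f) n * fdiff i (fdiff j g) n)"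
      by (simp only: R'_def P_def sum_subtractf fdiff_def[of _ "fdiff i f"]
          left_diff_distrib right_diff_distrib)
    then show ?thesis
      by (simp add: fdiff_commute[of _ i f])
  qed
  ultimately show ?thesis
    by (simp add: Q_def[abs_def] U_def)
qed

end

section \<open>Summation over all directions\<close>

theorem theorem3p3:
  fixes \<mu> :: "(nat ^ 'd::finite) pmf"
    and f g :: "nat ^ 'd \<Rightarrow> real"
    and a :: "nat ^ 'd \<Rightarrow> real"
  assumes "downward_closed (set_pmf \<mu>)"
    and "finite {n \<in> set_pmf \<mu>. f n \<noteq> 0}"
    and "finite {n \<in> set_pmf \<mu>. g n \<noteq> 0}"
  defines "a \<equiv> fact_weight \<mu>"
  shows "measure_pmf.expectation \<mu> (carre_du_champ2 (birth_death \<mu>) f g) =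
      measure_pmf.expectation \<mu> (\<lambda>n. \<Sum>i\<in>UNIV. \<Sum>j\<in>UNIV.
        a (n + axis i 1 + axis j 1) / a n * fdiff i (fdiff j f) n * fdiff i (fdiff j g) n)
    + measure_pmf.expectation \<mu> (\<lambda>n. \<Sum>i\<in>UNIV. \<Sum>j\<in>UNIV.
        (a (n + axis i 1) * a (n + axis j 1) / (a n)\<^sup>2 - a (n + axis i 1 + axis j 1) / a n)
          * fdiff i f n * fdiff j g n)
    + measure_pmf.expectation \<mu> (\<lambda>n. \<Sum>i\<in>UNIV.
        a (n + axis i 1) / a n * fdiff i f n * fdiff i g n)"
proof -
  let ?E = "measure_pmf.expectation \<mu>"
  let ?b = "birth_rate \<mu>"
  define c where "c i j n = ?b i n * ?b j (n + axis i 1)" for i j n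
  \<comment> \<open>These are the parts of direction \<open>i\<close> in the three expectations.
    Their finite support justifies exchanging the sum over \<open>i\<close> with the
    expectation.\<close>
  define T1 where "T1 i n = (\<Sum>j\<in>UNIV. c i j n * fdiff i (fdiff j f) n * fdiff i (fdiff j g) n)" for i n
  define T2 where "T2 i n = (\<Sum>j\<in>UNIV. (?b i n * ?b j n - c i j n) * fdiff i f n * fdiff j g n)" for i n
  define T3 where "T3 i n = ?b i n * fdiff i f n * fdiff i g n" for i n
  note dc = assms(1)
  have f: "finite_supp \<mu> f" and g: "finite_supp \<mu> g"
    using assms(2,3) by (simp_all add: finite_supp_def)
  note Df = finite_supp_birth_fdiff[OF dc f]
  have T2: "finite_supp \<mu> (T2 i)" for i
    unfolding T2_def[abs_def]
    by (intro finite_supp_sum; rule finite_supp_subset[OF Df[of i]]; auto simp: c_def)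
  have T3: "finite_supp \<mu> (T3 i)" for i
    unfolding T3_def[abs_def] by (intro finite_supp_mult_right Df)
  have c: "c i j n = a (n + axis i 1 + axis j 1) / a n" for i j n
    unfolding c_def a_def by (rule birth_rate_mult[OF dc])
  have T1: "finite_supp \<mu> (T1 i)" for i
    unfolding T1_def[abs_def]
  proof (rule finite_supp_sum)
    fix j
    \<comment> \<open>The weighted second difference is split into first differences of
      \<open>f\<close> at \<open>n + axis i 1\<close> and at \<open>n\<close>. In the latter the
      rates are commuted, so that \<open>?b j n\<close> stands next to
      \<open>fdiff j f n\<close>.\<close>
    have 1: "finite_supp \<mu> (\<lambda>n. ?b i n * (?b j (n + axis i 1) * fdiff j f (n + axis i 1)))"
      by (rule finite_supp_birth[OF dc Df])
    have 2: "finite_supp \<mu> (\<lambda>n. ?b i (n + axis j 1) * (?b j n * fdiff j f n))"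
      by (intro finite_supp_mult_left Df)
    have "finite_supp \<mu> (\<lambda>n. c i j n * fdiff i (fdiff j f) n)"
    proof -
      have "c i j n * fdiff i (fdiff j f) n
          = ?b i n * (?b j (n + axis i 1) * fdiff j f (n + axis i 1))
            - ?b i (n + axis j 1) * (?b j n * fdiff j f n)" for n
        using birth_rate_mult_commute[OF dc, of i n j]
        by (simp add: c_def fdiff_def[of i "fdiff j f"] right_diff_distrib)
      then show ?thesis
        using finite_supp_diff[OF 1 2] by simp
    qed
    then show "finite_supp \<mu> (\<lambda>n. c i j n * fdiff i (fdiff j f) n * fdiff i (fdiff j g) n)"
      by (rule finite_supp_mult_right)
  qed
  have "?E (carre_du_champ2 (birth_death \<mu>) f g)
      = (\<Sum>i\<in>UNIV. - ?E (\<lambda>n. ?b i n * fdiff i f n * fdiff i (birth_death \<mu> g) n))"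
    by (simp add: expectation_carre_du_champ2[OF dc f g] expectation_birth_death_mult[OF dc f] sum_negf)
  also have "\<dots> = (\<Sum>i\<in>UNIV. ?E (T1 i) + ?E (T2 i) + ?E (T3 i))"
    unfolding expectation_birth_fdiff_fdiff_birth_death[OF dc f g] T1_def T2_def T3_def c_def ..
  also have "\<dots> = ?E (\<lambda>n. \<Sum>i\<in>UNIV. T1 i n) + ?E (\<lambda>n. \<Sum>i\<in>UNIV. T2 i n) + ?E (\<lambda>n. \<Sum>i\<in>UNIV. T3 i n)"
    by (simp add: sum.distrib Bochner_Integration.integral_sum integrable_finite_supp T1 T2 T3)
  finally show ?thesis
    unfolding T1_def T2_def T3_def c
    by (simp add: birth_rate_def a_def power2_eq_square)
qed

end
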